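(* Let $K$ be a field, let $X,D$ satisfy $DX-XD=1$, and let $\mathfrak h$ be a polynomial in $X,D$ over $K$ with normal form $$\mathfrak{h}=\sum_{(r,s)\in \mathcal H} w_{r,s} X^r D^s ,$$ where $\mathcal H\subset \mathbb{Z}_{\ge0}\times\mathbb{Z}_{\ge0}$ is finite and $w_{r,s}\in K$. For $n\ge 0$ write the normal form of the power $\mathfrak h^n$ as $$\mathfrak N(\mathfrak{h}^n)=\sum_{a,b} c_{n,a,b}\, X^a D^b .$$ Then, for all $n,a,b\ge0$, the coefficient $c_{n,a,b}$ equals the total weight of the (monotonically) labelled diagrams that admit $\mathcal H$ as a basis weighted by $w$, have size $n$, and have exactly $a$ outputs and $b$ inputs.
   Context: Normal form: in the algebra $K\langle X,D\rangle/(DX-XD-1)$, every element $\mathfrak f$ can be written uniquely as a finite linear combination of monomials $X^aD^b$ (all $X$'s to the left of all $D$'s); this expression is the normal form $\mathfrak N(\mathfrak f)$. Gates: a gate of type $(r,s)$ (associated with $X^rD^s$) is an inner node with an ordered collection of $r$ outgoing edges (output slots) and an ordered collection of $s$ ingoing edges (input slots). Labelled diagrams with basis $\mathcal H$: a diagram is an acyclic directed multigraph assembled from gates, with an ordering fixed on the incoming and on the outgoing edges of each inner node; it need not be connected. Concretely, a labelled diagram of size $n$ with basis $\mathcal H$ consists of (i) inner nodes labelled $1,\dots,n$, node $j$ being a gate of type $(r_j,s_j)\in\mathcal H$; and (ii) a set of connections, each joining an output slot of a node $i$ to an input slot of a node $j$ with $i<j$ (labels increase along directed paths), each output slot and each input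 slot being used at most once. All slots of a node are distinguishable (ordered). The unconnected output slots are the outputs of the diagram and the unconnected input slots are its inputs. The size is the number of inner nodes (the empty diagram has size $0$). Weights: the weight of a diagram is the product of the weights $w_{r_j,s_j}$ of its gates; the total weight of a class of diagrams is the sum of the weights of its members. *)

theory Defs
  imports "HOL-Library.Poly_Mapping"
begin

section \<open>The algebra \<open>K\<langle>X,D\<rangle>/(DX - XD - 1)\<close>\<close>

datatype xd_letter = Letter_X | Letter_D

text \<open>
  The free monoid on two letters, written additively (although it is not commutative) because
  the convolution product on \<open>\<Rightarrow>\<^sub>0\<close> is indexed by a \<open>monoid_add\<close>. Thus \<open>xd_word \<Rightarrow>\<^sub>0 'k\<close>
  is the free associative algebra on two generators.
\<close>

datatype xd_word = Word (letters: "xd_letter list")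

instantiation xd_word :: monoid_add
begin

definition zero_xd_word :: xd_word where
  "0 = Word []"

definition plus_xd_word :: "xd_word \<Rightarrow> xd_word \<Rightarrow> xd_word" where
  "u + v = Word (letters u @ letters v)"

instance
  by standard (simp_all add: zero_xd_word_def plus_xd_word_def)

end

type_synonym 'k free_alg = "xd_word \<Rightarrow>\<^sub>0 'k"

definition free_X :: "'k::field free_alg" where
  "free_X = Poly_Mapping.single (Word [Letter_X]) 1"

definition free_D :: "'k::field free_alg" where
  "free_D = Poly_Mapping.single (Word [Letter_D]) 1"

definition free_const :: "'k::field \<Rightarrow> 'k free_alg" where
  "free_const c = Poly_Mapping.single 0 c"

text \<open>The two-sided ideal generated by \<open>DX - XD - 1\<close>.\<close>

inductive_set weyl_ideal :: "'k::field free_alg set" where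
  relation: "free_D * free_X - free_X * free_D - 1 \<in> weyl_ideal"
| zero: "0 \<in> weyl_ideal"
| add: "f \<in> weyl_ideal \<Longrightarrow> g \<in> weyl_ideal \<Longrightarrow> f + g \<in> weyl_ideal"
| mult_left: "f \<in> weyl_ideal \<Longrightarrow> g * f \<in> weyl_ideal"
| mult_right: "f \<in> weyl_ideal \<Longrightarrow> f * g \<in> weyl_ideal"

lemma weyl_ideal_uminus: "f \<in> weyl_ideal \<Longrightarrow> - f \<in> weyl_ideal"
  using weyl_ideal.mult_left[of f "- 1"] by simp

lemma weyl_ideal_diff: "f \<in> weyl_ideal \<Longrightarrow> g \<in> weyl_ideal \<Longrightarrow> f - g \<in> weyl_ideal"
  using weyl_ideal.add[of f "- g"] weyl_ideal_uminus[of g] by simp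

definition weyl_rel :: "'k::field free_alg \<Rightarrow> 'k free_alg \<Rightarrow> bool" where
  "weyl_rel f g \<longleftrightarrow> f - g \<in> weyl_ideal"

lemma equivp_weyl_rel: "equivp weyl_rel"
proof (rule equivpI)
  show "reflp weyl_rel"
    by (auto simp: reflp_def weyl_rel_def weyl_ideal.zero)
  show "symp weyl_rel"
    unfolding symp_def weyl_rel_def by (metis minus_diff_eq weyl_ideal_uminus)
  show "transp weyl_rel"
    unfolding transp_def weyl_rel_def
    by (metis add_diff_eq diff_add_cancel weyl_ideal.add)
qed

quotient_type (overloaded) 'k weyl = "('k::field) free_alg" / weyl_rel
  by (rule equivp_weyl_rel)

instantiation weyl :: (field) "{ring, monoid_mult}"
begin

lift_definition zero_weyl :: "'a weyl" is 0 .

lift_definition one_weyl :: "'a weyl" is 1 .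

lift_definition plus_weyl :: "'a weyl \<Rightarrow> 'a weyl \<Rightarrow> 'a weyl" is "(+)"
proof -
  fix f f' g g' :: "'a free_alg"
  assume "weyl_rel f f'" "weyl_rel g g'"
  moreover have "f + g - (f' + g') = (f - f') + (g - g')" by (simp add: algebra_simps)
  ultimately show "weyl_rel (f + g) (f' + g')"
    unfolding weyl_rel_def by (simp only: weyl_ideal.add)
qed

lift_definition minus_weyl :: "'a weyl \<Rightarrow> 'a weyl \<Rightarrow> 'a weyl" is "(-)"
proof -
  fix f f' g g' :: "'a free_alg"
  assume "weyl_rel f f'" "weyl_rel g g'"
  moreover have "f - g - (f' - g') = (f - f') - (g - g')" by (simp add: algebra_simps)
  ultimately show "weyl_rel (f - g) (f' - g')"
    unfolding weyl_rel_def by (simp only: weyl_ideal_diff)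
qed

lift_definition uminus_weyl :: "'a weyl \<Rightarrow> 'a weyl" is uminus
proof -
  fix f f' :: "'a free_alg"
  assume "weyl_rel f f'"
  moreover have "- f - - f' = - (f - f')" by simp
  ultimately show "weyl_rel (- f) (- f')"
    unfolding weyl_rel_def by (simp only: weyl_ideal_uminus)
qed

lift_definition times_weyl :: "'a weyl \<Rightarrow> 'a weyl \<Rightarrow> 'a weyl" is "(*)"
proof -
  fix f f' g g' :: "'a free_alg"
  assume "weyl_rel f f'" "weyl_rel g g'"
  moreover have "f * g - f' * g' = f * (g - g') + (f - f') * g'" by (simp add: algebra_simps)
  ultimately show "weyl_rel (f * g) (f' * g')"
    unfolding weyl_rel_def
    by (simp only: weyl_ideal.add weyl_ideal.mult_left weyl_ideal.mult_right)
qed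

instance
  by standard (transfer; simp add: weyl_rel_def weyl_ideal.zero algebra_simps)+

end

lift_definition weyl_X :: "'k::field weyl" is free_X .

lift_definition weyl_D :: "'k::field weyl" is free_D .

lift_definition weyl_const :: "'k::field \<Rightarrow> 'k weyl" is free_const .

lemma weyl_DX: "weyl_D * weyl_X - weyl_X * weyl_D = (1 :: 'k::field weyl)"
  by transfer (simp add: weyl_rel_def weyl_ideal.relation)

definition weyl_monom :: "'k::field \<Rightarrow> nat \<Rightarrow> nat \<Rightarrow> 'k weyl" where
  "weyl_monom c a b = weyl_const c * weyl_X ^ a * weyl_D ^ b"

definition normal_form :: "'k::field weyl \<Rightarrow> (nat \<times> nat) \<Rightarrow>\<^sub>0 'k" where
  "normal_form f = (THE c. f = (\<Sum>(a, b)\<in>Poly_Mapping.keys c.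
     weyl_monom (Poly_Mapping.lookup c (a, b)) a b))"


section \<open>Labelled diagrams\<close>

text \<open>
  \<open>gates d ! (j - 1)\<close> is the type \<open>(r, s)\<close> of the node with label \<open>j\<close>. A slot is a pair
  consisting of the label of its node and its position (counted from \<open>0\<close>) among the output,
  respectively input, slots of that node. A connection is a pair of an output slot and an input
  slot.
\<close>

type_synonym slot = "nat \<times> nat"

record diagram =
  gates :: "(nat \<times> nat) list"
  conns :: "(slot \<times> slot) set"

definition diagram_size :: "diagram \<Rightarrow> nat" where
  "diagram_size d = length (gates d)"

definition gate_type :: "diagram \<Rightarrow> nat \<Rightarrow> nat \<times> nat" where
  "gate_type d j = gates d ! (j - 1)"

definition out_slots :: "diagram \<Rightarrow> slot set" where
  "out_slots d = {(j, p). j \<in> {1..diagram_size d} \<and> p < fst (gate_type d j)}"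

definition in_slots :: "diagram \<Rightarrow> slot set" where
  "in_slots d = {(j, q). j \<in> {1..diagram_size d} \<and> q < snd (gate_type d j)}"

definition labelled_diagram :: "(nat \<times> nat) set \<Rightarrow> diagram \<Rightarrow> bool" where
  "labelled_diagram H d \<longleftrightarrow>
     (\<forall>j\<in>{1..diagram_size d}. gate_type d j \<in> H) \<and>
     conns d \<subseteq> out_slots d \<times> in_slots d \<and>
     (\<forall>((i, p), (j, q))\<in>conns d. i < j) \<and>
     inj_on fst (conns d) \<and> inj_on snd (conns d)"

definition outputs :: "diagram \<Rightarrow> slot set" where
  "outputs d = out_slots d - fst ` conns d"

definition inputs :: "diagram \<Rightarrow> slot set" where
  "inputs d = in_slots d - snd ` conns d"

definition diagram_weight :: "(nat \<times> nat \<Rightarrow> 'k::field) \<Rightarrow> diagram \<Rightarrow> 'k" where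
  "diagram_weight w d = (\<Prod>j = 1..diagram_size d. w (gate_type d j))"

definition total_weight :: "(nat \<times> nat \<Rightarrow> 'k::field) \<Rightarrow> diagram set \<Rightarrow> 'k" where
  "total_weight w C = (\<Sum>d\<in>C. diagram_weight w d)"

definition diagrams :: "(nat \<times> nat) set \<Rightarrow> nat \<Rightarrow> nat \<Rightarrow> nat \<Rightarrow> diagram set" where
  "diagrams H n a b =
     {d. labelled_diagram H d \<and> diagram_size d = n \<and>
         card (outputs d) = a \<and> card (inputs d) = b}"

text \<open>For finite \<open>H\<close> the sum defining the total weight of this class ranges over a finite set.\<close>

lemma finite_diagrams:
  assumes "finite H"
  shows "finite (diagrams H n a b)"
proof -
  define G where "G = {xs. set xs \<subseteq> H \<and> length xs = n}"
  have finG: "finite G"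
    unfolding G_def using assms by (rule finite_lists_length_eq)
  have slots: "finite (out_slots d)" "finite (in_slots d)" for d
  proof -
    have "out_slots d = (SIGMA j:{1..diagram_size d}. {..<fst (gate_type d j)})"
      by (auto simp: out_slots_def)
    then show "finite (out_slots d)" by simp
    have "in_slots d = (SIGMA j:{1..diagram_size d}. {..<snd (gate_type d j)})"
      by (auto simp: in_slots_def)
    then show "finite (in_slots d)" by simp
  qed
  define S where "S xs = Pow (out_slots \<lparr>gates = xs, conns = {}\<rparr> \<times>
    in_slots \<lparr>gates = xs, conns = {}\<rparr>)" for xs
  have "diagrams H n a b \<subseteq> (\<lambda>(xs, M). \<lparr>gates = xs, conns = M\<rparr>) ` Sigma G S"
  proof
    fix d assume d: "d \<in> diagrams H n a b"
    have "set (gates d) \<subseteq> H"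
    proof
      fix x assume "x \<in> set (gates d)"
      then obtain i where i: "i < length (gates d)" "x = gates d ! i"
        by (auto simp: in_set_conv_nth)
      then have "Suc i \<in> {1..diagram_size d}" by (simp add: diagram_size_def)
      with d have "gate_type d (Suc i) \<in> H"
        unfolding diagrams_def labelled_diagram_def by blast
      with i show "x \<in> H" by (simp add: gate_type_def)
    qed
    with d have "gates d \<in> G"
      by (auto simp: diagrams_def G_def diagram_size_def)
    moreover from d have "conns d \<in> S (gates d)"
      by (auto simp: diagrams_def labelled_diagram_def S_def out_slots_def in_slots_def
          diagram_size_def gate_type_def)
    ultimately have "(gates d, conns d) \<in> Sigma G S" by simp
    moreover have "d = (\<lambda>(xs, M). \<lparr>gates = xs, conns = M\<rparr>) (gates d, conns d)" by simp
    ultimately show "d \<in> (\<lambda>(xs, M). \<lparr>gates = xs, conns = M\<rparr>) ` Sigma G S"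
      by (rule rev_image_eqI)
  qed
  moreover have "finite (Sigma G S)"
    using finG slots by (auto simp: S_def)
  ultimately show ?thesis
    by (meson finite_imageI finite_subset)
qed

end

theory Submission
  imports Defs
begin

text \<open>
  Diagrams record how the letters \<open>D\<close> are moved to the right. When \<open>D\<^sup>s X\<^sup>A\<close> is rewritten with
  \<open>DX = XD + 1\<close>, every \<open>D\<close> either passes all the \<open>X\<close>'s on its right or is annihilated together
  with one of them. One term of the result is thus a partial matching between the \<open>s\<close> letters \<open>D\<close>
  and the \<open>A\<close> letters \<open>X\<close>, and a matching of size \<open>k\<close> leaves \<open>X\<^bsup>A-k\<^esup> D\<^bsup>s-k\<^esup>\<close>
  (lemma \<open>D_power_mult_X_power\<close>).

  A diagram with \<open>A\<close> outputs and \<open>B\<close> inputs stands for one term \<open>X\<^sup>A D\<^sup>B\<close> of \<open>h\<^sup>n\<close>. Multiplying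
  it on the left by \<open>X\<^sup>r D\<^sup>s\<close> appends a gate of type \<open>(r, s)\<close> with the new largest label \<open>n + 1\<close>:
  the \<open>s\<close> letters \<open>D\<close> are its input slots, the \<open>A\<close> letters \<open>X\<close> are the outputs of the old diagram,
  and the matching is the set of new connections. Since every diagram of size \<open>n + 1\<close> arises exactly
  once in this way (lemma \<open>bij_betw_add_gate\<close>), induction on \<open>n\<close> writes \<open>h\<^sup>n\<close> as the sum over all diagrams
  of size \<open>n\<close> of weight times \<open>X\<^sup>A D\<^sup>B\<close> (lemma \<open>power_eq_sum_diagrams\<close>).

  To read off coefficients, the monomials \<open>X\<^sup>a D\<^sup>b\<close> must be linearly independent over a field of
  any characteristic. Differential operators on \<open>K[x]\<close> do not show this when \<open>K\<close> has characteristic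
  \<open>p > 0\<close>, because there \<open>D\<^sup>p\<close> acts as zero. Instead, \<open>X\<close> and \<open>D\<close> act on families of coefficients
  indexed by \<open>(a, b)\<close> in the way that left multiplication acts on normal forms; the relation is
  verified by calculation, and \<open>X\<^sup>a D\<^sup>b\<close> sends the unit family at \<open>(0, 0)\<close> to the one at \<open>(a, b)\<close>.
\<close>

section \<open>Independence of the normally ordered monomials\<close>

text \<open>
  A function \<open>c\<close> stands for the formal sum of all \<open>c (a, b) X\<^sup>a D\<^sup>b\<close>. The equation for \<open>D\<close> is
  \<open>D X\<^sup>a D\<^sup>b = X\<^sup>a D\<^bsup>b+1\<^esup> + a X\<^bsup>a-1\<^esup> D\<^sup>b\<close>, sorted by the monomials on the right-hand side.
\<close>

fun letter_act :: "xd_letter \<Rightarrow> (nat \<times> nat \<Rightarrow> 'k::field) \<Rightarrow> nat \<times> nat \<Rightarrow> 'k" where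
  "letter_act Letter_X c = (\<lambda>(a, b). case a of 0 \<Rightarrow> 0 | Suc a' \<Rightarrow> c (a', b))"
| "letter_act Letter_D c =
     (\<lambda>(a, b). (case b of 0 \<Rightarrow> 0 | Suc b' \<Rightarrow> c (a, b')) + of_nat (Suc a) * c (Suc a, b))"

definition word_act :: "xd_word \<Rightarrow> (nat \<times> nat \<Rightarrow> 'k::field) \<Rightarrow> nat \<times> nat \<Rightarrow> 'k" where
  "word_act u = List.foldr letter_act (letters u)"

definition free_act :: "'k::field free_alg \<Rightarrow> (nat \<times> nat \<Rightarrow> 'k) \<Rightarrow> nat \<times> nat \<Rightarrow> 'k" where
  "free_act f c = (\<lambda>p. \<Sum>u\<in>Poly_Mapping.keys f. Poly_Mapping.lookup f u * word_act u c p)"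

lemma letter_act_add: "letter_act l (\<lambda>p. c p + c' p) = (\<lambda>p. letter_act l c p + letter_act l c' p)"
  by (cases l) (auto simp: fun_eq_iff algebra_simps split: nat.splits)

lemma letter_act_scale: "letter_act l (\<lambda>p. k * c p) = (\<lambda>p. k * letter_act l c p)"
  by (cases l) (auto simp: fun_eq_iff algebra_simps split: nat.splits)

lemma word_act_add: "word_act u (\<lambda>p. c p + c' p) = (\<lambda>p. word_act u c p + word_act u c' p)"
proof -
  have "List.foldr letter_act ls (\<lambda>p. c p + c' p) =
      (\<lambda>p. List.foldr letter_act ls c p + List.foldr letter_act ls c' p)" for ls
    by (induction ls) (simp_all add: letter_act_add)
  then show ?thesis by (simp add: word_act_def)
qed

lemma word_act_scale: "word_act u (\<lambda>p. k * c p) = (\<lambda>p. k * word_act u c p)"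
proof -
  have "List.foldr letter_act ls (\<lambda>p. k * c p) = (\<lambda>p. k * List.foldr letter_act ls c p)" for ls
    by (induction ls) (simp_all add: letter_act_scale)
  then show ?thesis by (simp add: word_act_def)
qed

lemma free_act_single [simp]: "free_act (Poly_Mapping.single u k) c = (\<lambda>p. k * word_act u c p)"
  by (simp add: free_act_def)

lemma free_act_add: "free_act (f + g) c = (\<lambda>p. free_act f c p + free_act g c p)"
proof
  fix p
  let ?K = "Poly_Mapping.keys f \<union> Poly_Mapping.keys g"
  \<comment> \<open>The support of \<open>f + g\<close> may be smaller than the union \<open>?K\<close>, so all three sums are taken over \<open>?K\<close>.\<close>
  have expand: "free_act f' c p = (\<Sum>u\<in>?K. Poly_Mapping.lookup f' u * word_act u c p)"
    if "Poly_Mapping.keys f' \<subseteq> ?K" for f'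
    unfolding free_act_def using that
    by (intro sum.mono_neutral_left) (auto simp: in_keys_iff)
  show "free_act (f + g) c p = free_act f c p + free_act g c p"
    using keys_add[of f g] by (simp add: expand lookup_add distrib_right sum.distrib)
qed

lemma free_act_zero [simp]: "free_act 0 c = (\<lambda>p. 0)"
  by (simp add: free_act_def)

lemma free_act_diff: "free_act (f - g) c = (\<lambda>p. free_act f c p - free_act g c p)"
  using free_act_add[of "f - g" g c] by (simp add: fun_eq_iff)

lemma free_act_add_right: "free_act f (\<lambda>p. c p + c' p) = (\<lambda>p. free_act f c p + free_act f c' p)"
  by (simp add: free_act_def word_act_add distrib_left sum.distrib)

lemma free_act_zero_right: "free_act (f :: 'a::field free_alg) (\<lambda>p. 0) = (\<lambda>p. 0)"
  using word_act_scale[of _ 0 "\<lambda>p. 0 :: 'a"] by (simp add: free_act_def)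

text \<open>
  The words span the free algebra, so an additive property need only be checked on scalar
  multiples of words.
\<close>

lemma free_alg_induct [case_names single add]:
  fixes f :: "'k::field free_alg"
  assumes "\<And>u k. P (Poly_Mapping.single u k)" and "\<And>f g. P f \<Longrightarrow> P g \<Longrightarrow> P (f + g)"
  shows "P f"
proof (induction f rule: update_induct)
  case const
  then show ?case using assms(1)[of 0 0] by simp
next
  case (update f a b)
  have "Poly_Mapping.update a b f = f + Poly_Mapping.single a b"
    using update(1) by (intro poly_mapping_eqI)
      (auto simp: lookup_update lookup_add lookup_single when_def in_keys_iff)
  with update assms show ?case by simp
qed

lemma free_act_mult: "free_act (f * g) c = free_act f (free_act g c)"
proof (induction f rule: free_alg_induct)
  case (single u k)
  show ?case
  proof (induction g rule: free_alg_induct)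
    case (single v l)
    show ?case
      by (simp add: mult_single word_act_scale mult.assoc)
        (simp add: word_act_def plus_xd_word_def)
  next
    case (add f g)
    then show ?case
      by (simp only: distrib_left free_act_add free_act_add_right)
  qed
next
  case (add f g)
  then show ?case
    by (simp only: distrib_right free_act_add)
qed

lemma word_act_empty [simp]: "word_act 0 c = c"
  by (simp add: word_act_def zero_xd_word_def)

lemma free_act_one: "free_act 1 c = c"
  by (simp flip: single_one)

text \<open>
  With \<open>a\<close> the exponent of \<open>X\<close>, the factors \<open>a + 1\<close> in \<open>DX\<close> and \<open>a\<close> in \<open>XD\<close> differ by one, so
  the relation acts as zero. Elements acting as zero form a two-sided ideal, hence the action
  descends to the quotient.
\<close>

lemma free_act_weyl_ideal: "f \<in> weyl_ideal \<Longrightarrow> free_act f c = (\<lambda>p. 0)"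
proof (induction f arbitrary: c rule: weyl_ideal.induct)
  case relation
  show ?case
    unfolding free_act_diff free_act_mult free_act_one free_X_def free_D_def
    by (auto simp: word_act_def fun_eq_iff algebra_simps split: nat.splits)
qed (simp_all add: free_act_add free_act_mult free_act_zero_right)

lemma weyl_rel_refl [simp]: "weyl_rel f f"
  by (simp add: weyl_rel_def weyl_ideal.zero)

lift_definition weyl_act :: "'k::field weyl \<Rightarrow> (nat \<times> nat \<Rightarrow> 'k) \<Rightarrow> nat \<times> nat \<Rightarrow> 'k" is free_act
  by (metis free_act_diff free_act_weyl_ideal weyl_rel_def eq_iff_diff_eq_0 ext)

lemma weyl_act_zero: "weyl_act 0 c = (\<lambda>p. 0)"
  by transfer simp

lemma weyl_act_one: "weyl_act 1 c = c"
  by transfer (rule free_act_one)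

lemma weyl_act_add: "weyl_act (f + g) c = (\<lambda>p. weyl_act f c p + weyl_act g c p)"
  by transfer (rule free_act_add)

lemma weyl_act_mult: "weyl_act (f * g) c = weyl_act f (weyl_act g c)"
  by transfer (rule free_act_mult)

lemma weyl_act_sum: "weyl_act (sum f I) c p = (\<Sum>i\<in>I. weyl_act (f i) c p)"
  by (induction I rule: infinite_finite_induct) (simp_all add: weyl_act_zero weyl_act_add)

lemma weyl_act_X: "weyl_act weyl_X = letter_act Letter_X"
  by transfer (simp add: fun_eq_iff free_X_def word_act_def)

lemma weyl_act_D: "weyl_act weyl_D = letter_act Letter_D"
  by transfer (simp add: fun_eq_iff free_D_def word_act_def)

lemma weyl_act_const: "weyl_act (weyl_const k) c = (\<lambda>p. k * c p)"
  by transfer (simp add: free_const_def)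

definition unit_vec :: "nat \<times> nat \<Rightarrow> nat \<times> nat \<Rightarrow> 'k::field" where
  "unit_vec q = (\<lambda>p. if p = q then 1 else 0)"

lemma weyl_act_monom:
  "weyl_act (weyl_monom k a b) (unit_vec (0, 0)) p = (if p = (a, b) then k else 0)"
proof -
  have "letter_act Letter_D (unit_vec (0, j)) = (unit_vec (0, Suc j) :: _ \<Rightarrow> 'a)" for j
    by (auto simp: unit_vec_def fun_eq_iff split: nat.splits)
  then have D: "weyl_act (weyl_D ^ b) (unit_vec (0, 0)) = (unit_vec (0, b) :: _ \<Rightarrow> 'a)"
    by (induction b) (simp_all add: weyl_act_one weyl_act_mult weyl_act_D)
  have "letter_act Letter_X (unit_vec (i, b)) = (unit_vec (Suc i, b) :: _ \<Rightarrow> 'a)" for i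
    by (auto simp: unit_vec_def fun_eq_iff split: nat.splits)
  then have X: "weyl_act (weyl_X ^ a) (unit_vec (0, b)) = (unit_vec (a, b) :: _ \<Rightarrow> 'a)"
    by (induction a) (simp_all add: weyl_act_one weyl_act_mult weyl_act_X)
  show ?thesis
    by (simp add: weyl_monom_def weyl_act_mult weyl_act_const D X)
      (simp add: unit_vec_def)
qed

lemma weyl_const_add: "weyl_const (k + l) = weyl_const k + weyl_const l"
  by transfer (simp add: free_const_def single_add)

lemma weyl_const_zero [simp]: "weyl_const 0 = 0"
  by transfer (simp add: free_const_def)

lemma weyl_const_mult: "weyl_const (k * l) = weyl_const k * weyl_const l"
  by transfer (simp add: free_const_def mult_single)

lemma weyl_const_one: "weyl_const 1 = 1"
  by transfer (simp add: free_const_def)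

lemma weyl_monom_zero [simp]: "weyl_monom 0 a b = 0"
  by (simp add: weyl_monom_def)

lemma weyl_monom_add: "weyl_monom (k + l) a b = weyl_monom k a b + weyl_monom l a b"
  by (simp add: weyl_monom_def weyl_const_add distrib_right)

lemma weyl_monom_sum: "weyl_monom (sum k I) a b = (\<Sum>i\<in>I. weyl_monom (k i) a b)"
  by (induction I rule: infinite_finite_induct) (simp_all add: weyl_monom_add)

definition is_normal_form :: "((nat \<times> nat) \<Rightarrow>\<^sub>0 'k::field) \<Rightarrow> 'k weyl \<Rightarrow> bool" where
  "is_normal_form c f \<longleftrightarrow>
    f = (\<Sum>(a, b)\<in>Poly_Mapping.keys c. weyl_monom (Poly_Mapping.lookup c (a, b)) a b)"

text \<open>
  The coefficients of a normal form are recovered from the algebra element alone; this is the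
  uniqueness of normal forms.
\<close>

lemma lookup_is_normal_form:
  assumes "is_normal_form c f"
  shows "Poly_Mapping.lookup c p = weyl_act f (unit_vec (0, 0)) p"
proof (cases p)
  case (Pair a b)
  have "weyl_act f (unit_vec (0, 0)) p =
      (\<Sum>q\<in>Poly_Mapping.keys c. if p = q then Poly_Mapping.lookup c q else 0)"
    using assms
    by (auto simp: is_normal_form_def weyl_act_sum weyl_act_monom split_def intro!: sum.cong)
  also have "\<dots> = Poly_Mapping.lookup c p"
    by (simp add: in_keys_iff)
  finally show ?thesis ..
qed

lemma normal_form_eqI:
  assumes "is_normal_form c f"
  shows "normal_form f = c"
  unfolding normal_form_def is_normal_form_def[symmetric]
proof (rule the_equality)
  fix c' assume "is_normal_form c' f"
  with assms show "c' = c" by (intro poly_mapping_eqI) (simp add: lookup_is_normal_form)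
qed (rule assms)

text \<open>
  Every finite sum of normally ordered monomials, possibly with repetitions, becomes a normal form
  once the terms with equal exponents are collected. Coefficients that cancel in the process fall
  out of the support of \<open>c\<close>, whose keys may therefore be fewer than the occurring exponents.
\<close>

lemma lookup_normal_form_sum:
  assumes "finite I"
  shows "Poly_Mapping.lookup (normal_form (\<Sum>i\<in>I. weyl_monom (k i) (\<alpha> i) (\<beta> i))) (a, b) =
    (\<Sum>i | i \<in> I \<and> \<alpha> i = a \<and> \<beta> i = b. k i)"
proof -
  define f where "f = (\<Sum>i\<in>I. weyl_monom (k i) (\<alpha> i) (\<beta> i))"
  define m where "m = (\<lambda>i. Poly_Mapping.single (\<alpha> i, \<beta> i) (k i))"
  define c where "c = sum m I"
  have lookup_c: "Poly_Mapping.lookup c q = (\<Sum>i | i \<in> I \<and> (\<alpha> i, \<beta> i) = q. k i)" for q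
    using assms by (auto simp: c_def m_def lookup_sum lookup_single when_def sum.inter_filter)
  let ?J = "(\<lambda>i. (\<alpha> i, \<beta> i)) ` I"
  have "f = (\<Sum>q\<in>?J. \<Sum>i | i \<in> I \<and> (\<alpha> i, \<beta> i) = q. weyl_monom (k i) (\<alpha> i) (\<beta> i))"
    unfolding f_def using assms by (rule sum.image_gen)
  also have "\<dots> = (\<Sum>q\<in>?J. weyl_monom (Poly_Mapping.lookup c q) (fst q) (snd q))"
    unfolding lookup_c weyl_monom_sum by (intro sum.cong) auto
  also have "\<dots> = (\<Sum>q\<in>Poly_Mapping.keys c. weyl_monom (Poly_Mapping.lookup c q) (fst q) (snd q))"
  proof (rule sum.mono_neutral_right)
    show "Poly_Mapping.keys c \<subseteq> ?J"
    proof
      fix q assume "q \<in> Poly_Mapping.keys c"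
      then have "{i \<in> I. (\<alpha> i, \<beta> i) = q} \<noteq> {}"
        using lookup_c[of q] by (metis (lifting) in_keys_iff sum.empty)
      then show "q \<in> ?J" by blast
    qed
  qed (use assms in \<open>auto simp: in_keys_iff\<close>)
  finally have "is_normal_form c f"
    by (simp add: is_normal_form_def split_def)
  then show ?thesis
    by (simp add: normal_form_eqI lookup_c flip: f_def)
qed

section \<open>Reordering a product of monomials\<close>

lemma weyl_const_X: "weyl_const k * weyl_X = weyl_X * weyl_const k"
  by transfer (simp add: free_const_def free_X_def mult_single)

lemma weyl_const_D: "weyl_const k * weyl_D = weyl_D * weyl_const k"
  by transfer (simp add: free_const_def free_D_def mult_single)

definition matchings :: "'o set \<Rightarrow> 'i set \<Rightarrow> ('o \<times> 'i) set set" where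
  "matchings P Q = {M. M \<subseteq> P \<times> Q \<and> inj_on fst M \<and> inj_on snd M}"

lemma finite_matchings: "finite P \<Longrightarrow> finite Q \<Longrightarrow> finite (matchings P Q)"
  by (rule finite_subset[of _ "Pow (P \<times> Q)"]) (auto simp: matchings_def)

lemma matchings_empty: "matchings P {} = {{}}"
  by (auto simp: matchings_def)

lemma matching_card:
  assumes "M \<in> matchings P Q" "finite P" "finite Q"
  shows "finite M" "card M \<le> card Q" "card (P - fst ` M) = card P - card M"
    "card (Q - snd ` M) = card Q - card M"
proof -
  have M: "M \<subseteq> P \<times> Q" "inj_on fst M" "inj_on snd M"
    using assms(1) by (auto simp: matchings_def)
  then have sub: "fst ` M \<subseteq> P" "snd ` M \<subseteq> Q" by auto
  have c: "card (fst ` M) = card M" "card (snd ` M) = card M" using M by (auto simp: card_image)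
  show "finite M" using M(1) assms by (meson finite_SigmaI finite_subset)
  show "card M \<le> card Q"
    using sub c assms by (metis card_mono)
  show "card (P - fst ` M) = card P - card M" "card (Q - snd ` M) = card Q - card M"
    using sub c assms by (metis card_Diff_subset finite_subset)+
qed

text \<open>
  The factor \<open>card R\<close> that comes from differentiating \<open>X\<^bsup>card R\<^esup>\<close> is written as a sum over the
  elements of \<open>R\<close>: each summand is the letter \<open>X\<close> that \<open>D\<close> is matched with.
\<close>

lemma D_mult_X_power:
  assumes "finite R"
  shows "weyl_D * weyl_X ^ card R =
    (weyl_X ^ card R * weyl_D + (\<Sum>_\<in>R. weyl_X ^ (card R - 1)) :: 'k::field weyl)"
  using assms
proof (induction R rule: finite_induct)
  case empty
  then show ?case by simp
next
  case (insert x R)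
  have DX: "weyl_D * weyl_X = weyl_X * weyl_D + (1 :: 'k weyl)"
    using weyl_DX by (simp add: algebra_simps)
  have X: "(\<Sum>_\<in>R. weyl_X * weyl_X ^ (card R - Suc 0)) = (\<Sum>_\<in>R. weyl_X ^ card R :: 'k weyl)"
  proof (rule sum.cong[OF refl])
    fix y assume "y \<in> R"
    then obtain m where "card R = Suc m"
      using insert(1) by (metis card_Suc_Diff1)
    then show "weyl_X * weyl_X ^ (card R - Suc 0) = (weyl_X ^ card R :: 'k weyl)" by simp
  qed
  have "weyl_D * weyl_X ^ card (insert x R) = (weyl_D * weyl_X) * weyl_X ^ card R"
    using insert by (simp add: mult.assoc)
  also have "\<dots> = weyl_X * (weyl_D * weyl_X ^ card R) + (weyl_X ^ card R :: 'k weyl)"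
    by (simp add: DX distrib_right mult.assoc)
  also have "\<dots> = weyl_X ^ Suc (card R) * weyl_D + (weyl_X ^ card R + (\<Sum>_\<in>R. weyl_X ^ card R))"
    by (simp add: insert.IH distrib_left sum_distrib_left X mult.assoc algebra_simps)
  finally show ?case using insert by simp
qed

text \<open>
  In a matching of \<open>insert q Q\<close> the element \<open>q\<close> is either unmatched or has a unique partner, which
  is free in the matching that remains when \<open>q\<close> is removed.
\<close>

lemma sum_matchings_insert:
  fixes F :: "('o \<times> 'i) set \<Rightarrow> 'c::comm_monoid_add"
  assumes "finite P" "finite Q" "q \<notin> Q"
  shows "(\<Sum>M\<in>matchings P (insert q Q). F M) =
    (\<Sum>M\<in>matchings P Q. F M + (\<Sum>x\<in>P - fst ` M. F (insert (x, q) M)))"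
proof -
  let ?A = "matchings P Q"
  let ?B = "{M \<in> matchings P (insert q Q). q \<in> snd ` M}"
  have A: "{M \<in> matchings P (insert q Q). q \<notin> snd ` M} = ?A"
    using assms(3) by (force simp: matchings_def)
  have split: "matchings P (insert q Q) = ?A \<union> ?B"
    unfolding A[symmetric] by auto
  have disjoint: "?A \<inter> ?B = {}"
    unfolding A[symmetric] by auto
  have fin: "finite ?A" "finite ?B"
    using assms by (auto simp: finite_matchings)
  have "(\<Sum>M\<in>matchings P (insert q Q). F M) = sum F ?A + sum F ?B"
    by (subst split) (rule sum.union_disjoint[OF fin disjoint])
  also have "sum F ?B = (\<Sum>(M, x)\<in>(SIGMA M:?A. P - fst ` M). F (insert (x, q) M))"
  proof (rule sum.reindex_bij_witness[where
        i = "\<lambda>(M, x). insert (x, q) M" and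
        j = "\<lambda>M. ({c \<in> M. snd c \<noteq> q}, THE x. (x, q) \<in> M)"])
    fix M assume M: "M \<in> ?B"
    then have inj: "inj_on fst M" "inj_on snd M" and sub: "M \<subseteq> P \<times> insert q Q"
      by (auto simp: matchings_def)
    from M obtain x where x: "(x, q) \<in> M" by auto
    have uniq: "y = x" if "(y, q) \<in> M" for y
      using inj_onD[OF inj(2) _ that x] by simp
    have the: "(THE y. (y, q) \<in> M) = x"
      using x uniq by blast
    have "c = (x, q)" if "c \<in> M" "snd c = q" for c
      using inj_onD[OF inj(2) _ that(1) x] that(2) by simp
    then have restore: "insert (x, q) {c \<in> M. snd c \<noteq> q} = M"
      using x by blast
    show eq: "(case ({c \<in> M. snd c \<noteq> q}, THE x. (x, q) \<in> M) of (M, x) \<Rightarrow> insert (x, q) M) = M"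
      by (simp add: the restore)
    have "x \<notin> fst ` {c \<in> M. snd c \<noteq> q}"
    proof
      assume "x \<in> fst ` {c \<in> M. snd c \<noteq> q}"
      then obtain c where "c \<in> M" "snd c \<noteq> q" "fst c = x" by auto
      then show False using inj_onD[OF inj(1) _ _ x, of c] by auto
    qed
    moreover have "{c \<in> M. snd c \<noteq> q} \<in> ?A"
      using inj sub by (auto simp: matchings_def intro: inj_on_subset)
    ultimately show "({c \<in> M. snd c \<noteq> q}, THE x. (x, q) \<in> M) \<in> (SIGMA M:?A. P - fst ` M)"
      using x sub by (auto simp: the)
    show "(case ({c \<in> M. snd c \<noteq> q}, THE x. (x, q) \<in> M) of (M, x) \<Rightarrow> F (insert (x, q) M)) = F M"
      using eq by (simp add: split_def)
  next
    fix t assume "t \<in> (SIGMA M:?A. P - fst ` M)"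
    then obtain M x where t: "t = (M, x)" and M: "M \<in> ?A" and x: "x \<in> P" "x \<notin> fst ` M"
      by auto
    then have sub: "M \<subseteq> P \<times> Q" by (auto simp: matchings_def)
    have q: "q \<notin> snd ` M" using sub assms(3) by auto
    then have 1: "{c \<in> insert (x, q) M. snd c \<noteq> q} = M" by force
    have 2: "(THE y. (y, q) \<in> insert (x, q) M) = x" using q by (intro the_equality) force+
    show "(\<lambda>M. ({c \<in> M. snd c \<noteq> q}, THE x. (x, q) \<in> M)) (case t of (M, x) \<Rightarrow> insert (x, q) M) = t"
      using 1 2 by (simp add: t)
    show "(case t of (M, x) \<Rightarrow> insert (x, q) M) \<in> ?B"
      using M x q by (auto simp: t matchings_def)
  qed
  also have "\<dots> = (\<Sum>M\<in>?A. \<Sum>x\<in>P - fst ` M. F (insert (x, q) M))"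
    using fin assms by (subst sum.Sigma) auto
  finally show ?thesis by (simp add: sum.distrib)
qed

text \<open>
  Moving one more \<open>D\<close> (the element \<open>q\<close>) past the \<open>X\<close>'s that are still unmatched either leaves it
  unmatched or matches it with one of them. This is the recursion of \<open>sum_matchings_insert\<close>.
\<close>

lemma D_power_mult_X_power:
  assumes "finite P" "finite Q"
  shows "weyl_D ^ card Q * weyl_X ^ card P =
    (\<Sum>M\<in>matchings P Q. weyl_X ^ (card P - card M) * weyl_D ^ (card Q - card M) :: 'k::field weyl)"
  using assms(2)
proof (induction Q rule: finite_induct)
  case empty
  show ?case by (simp add: matchings_empty)
next
  case (insert q Q)
  define t where "t M = (weyl_X ^ (card P - card M) * weyl_D ^ (Suc (card Q) - card M) :: 'k weyl)"
    for M :: "('a \<times> 'b) set"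
  have step: "weyl_D * (weyl_X ^ (card P - card M) * weyl_D ^ (card Q - card M)) =
      t M + (\<Sum>x\<in>P - fst ` M. t (insert (x, q) M))" if M: "M \<in> matchings P Q" for M
  proof -
    note card = matching_card[OF M assms(1) insert(1)]
    let ?R = "P - fst ` M"
    have "(\<Sum>x\<in>?R. t (insert (x, q) M)) =
        (\<Sum>x\<in>?R. weyl_X ^ (card P - card M - 1) * weyl_D ^ (card Q - card M))"
    proof (rule sum.cong[OF refl])
      fix x assume "x \<in> ?R"
      then have "(x, q) \<notin> M" by force
      then show "t (insert (x, q) M) =
          weyl_X ^ (card P - card M - 1) * weyl_D ^ (card Q - card M)"
        using card(1) by (simp add: t_def)
    qed
    moreover have "t M = weyl_X ^ (card P - card M) * weyl_D * weyl_D ^ (card Q - card M)"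
      using card(2) by (simp add: t_def Suc_diff_le mult.assoc)
    moreover have "weyl_D * weyl_X ^ (card P - card M) =
        weyl_X ^ (card P - card M) * weyl_D + (\<Sum>_\<in>?R. weyl_X ^ (card P - card M - 1) :: 'k weyl)"
      using D_mult_X_power[of ?R] assms(1) card(3) by simp
    ultimately show ?thesis
      by (simp add: distrib_right sum_distrib_right flip: mult.assoc)
  qed
  have "weyl_D ^ card (insert q Q) * weyl_X ^ card P =
      weyl_D * (weyl_D ^ card Q * weyl_X ^ card P :: 'k weyl)"
    using insert by (simp add: mult.assoc)
  also have "\<dots> = (\<Sum>M\<in>matchings P Q. t M + (\<Sum>x\<in>P - fst ` M. t (insert (x, q) M)))"
    by (simp add: insert.IH sum_distrib_left step)
  also have "\<dots> = (\<Sum>M\<in>matchings P (insert q Q). t M)"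
    using assms(1) insert by (simp add: sum_matchings_insert)
  finally show ?case using insert by (simp add: t_def)
qed

text \<open>
  Scalars commute with both generators, so in a product of two monomials only the inner block
  \<open>D\<^bsup>card Q\<^esup> X\<^bsup>card P\<^esup>\<close> has to be reordered.
\<close>

lemma weyl_monom_mult:
  assumes "finite P" "finite Q"
  shows "weyl_monom k r (card Q) * weyl_monom l (card P) b =
    (\<Sum>M\<in>matchings P Q. weyl_monom (k * l) (r + (card P - card M)) (card Q - card M + b))"
proof -
  let ?X = weyl_X and ?D = weyl_D and ?k = "weyl_const k" and ?l = "weyl_const l"
  have comm: "?l * ?X ^ r = ?X ^ r * ?l" "?l * ?D ^ s = ?D ^ s * ?l" for s
    using power_commuting_commutes[OF weyl_const_X[symmetric], of r l]
      power_commuting_commutes[OF weyl_const_D[symmetric], of s l] by simp_all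
  have "weyl_monom k r (card Q) * weyl_monom l (card P) b =
      ?k * (?X ^ r * (?D ^ card Q * ?l)) * (?X ^ card P * ?D ^ b)"
    by (simp add: weyl_monom_def mult.assoc)
  also have "\<dots> = ?k * ((?X ^ r * ?l) * ?D ^ card Q) * (?X ^ card P * ?D ^ b)"
    by (simp add: mult.assoc flip: comm(2))
  also have "\<dots> = weyl_const (k * l) * ?X ^ r * (?D ^ card Q * ?X ^ card P) * ?D ^ b"
    by (simp add: mult.assoc weyl_const_mult flip: comm(1))
  also have "\<dots> = (\<Sum>M\<in>matchings P Q. weyl_const (k * l) * ?X ^ r *
      (?X ^ (card P - card M) * ?D ^ (card Q - card M)) * ?D ^ b)"
    by (simp only: D_power_mult_X_power[OF assms] sum_distrib_left sum_distrib_right)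
  also have "\<dots> =
      (\<Sum>M\<in>matchings P Q. weyl_monom (k * l) (r + (card P - card M)) (card Q - card M + b))"
    by (simp add: weyl_monom_def mult.assoc power_add)
  finally show ?thesis .
qed


section \<open>Growing a diagram by its last node\<close>

definition diagrams_of_size :: "(nat \<times> nat) set \<Rightarrow> nat \<Rightarrow> diagram set" where
  "diagrams_of_size H n = {d. labelled_diagram H d \<and> diagram_size d = n}"

definition add_gate :: "diagram \<Rightarrow> nat \<times> nat \<Rightarrow> (slot \<times> slot) set \<Rightarrow> diagram" where
  "add_gate d g M = \<lparr>gates = gates d @ [g], conns = conns d \<union> M\<rparr>"

definition new_slots :: "diagram \<Rightarrow> nat \<Rightarrow> slot set" where
  "new_slots d k = {Suc (diagram_size d)} \<times> {..<k}"

definition extensions :: "(nat \<times> nat) set \<Rightarrow> nat \<Rightarrow>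
    (diagram \<times> (nat \<times> nat) \<times> (slot \<times> slot) set) set" where
  "extensions H n = (SIGMA d:diagrams_of_size H n. SIGMA g:H.
     matchings (outputs d) (new_slots d (snd g)))"

lemma new_slots_card [simp]: "finite (new_slots d k)" "card (new_slots d k) = k"
  by (simp_all add: new_slots_def card_cartesian_product)

lemma finite_slots [simp]: "finite (out_slots d)" "finite (in_slots d)"
proof -
  have "out_slots d = (SIGMA j:{1..diagram_size d}. {..<fst (gate_type d j)})"
    by (auto simp: out_slots_def)
  then show "finite (out_slots d)" by simp
  have "in_slots d = (SIGMA j:{1..diagram_size d}. {..<snd (gate_type d j)})"
    by (auto simp: in_slots_def)
  then show "finite (in_slots d)" by simp
qed

lemma finite_outputs_inputs [simp]: "finite (outputs d)" "finite (inputs d)"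
  by (simp_all add: outputs_def inputs_def)

lemma gate_type_snoc:
  assumes "gates d' = gates d @ [g]" "j \<in> {1..Suc (diagram_size d)}"
  shows "gate_type d' j = (if j = Suc (diagram_size d) then g else gate_type d j)"
  using assms by (auto simp: gate_type_def diagram_size_def nth_append)

lemma slots_snoc:
  assumes "gates d' = gates d @ [g]"
  shows "out_slots d' = out_slots d \<union> new_slots d (fst g)"
    and "in_slots d' = in_slots d \<union> new_slots d (snd g)"
    and "diagram_size d' = Suc (diagram_size d)"
proof -
  show size: "diagram_size d' = Suc (diagram_size d)"
    using assms by (simp add: diagram_size_def)
  have new: "gate_type d' (Suc (diagram_size d)) = g"
    by (simp add: gate_type_snoc[OF assms])
  have old: "gate_type d' j = gate_type d j" if "1 \<le> j" "j \<le> diagram_size d" for j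
    using that by (simp add: gate_type_snoc[OF assms])
  show "out_slots d' = out_slots d \<union> new_slots d (fst g)"
    by (auto simp: new old out_slots_def new_slots_def size le_Suc_eq split: if_splits)
  show "in_slots d' = in_slots d \<union> new_slots d (snd g)"
    by (auto simp: new old in_slots_def new_slots_def size le_Suc_eq split: if_splits)
qed

lemma new_slots_disjoint:
  "out_slots d \<inter> new_slots d k = {}" "in_slots d \<inter> new_slots d k = {}"
  by (auto simp: out_slots_def in_slots_def new_slots_def)

lemma labelled_diagramD:
  assumes "labelled_diagram H d"
  shows "conns d \<subseteq> out_slots d \<times> in_slots d" "inj_on fst (conns d)" "inj_on snd (conns d)"
    "((i, p), (j, q)) \<in> conns d \<Longrightarrow> i < j"
  using assms by (auto simp: labelled_diagram_def)

lemma add_gate_simps [simp]: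
  "gates (add_gate d g M) = gates d @ [g]" "conns (add_gate d g M) = conns d \<union> M"
  by (simp_all add: add_gate_def)

lemma labelled_diagram_add_gate:
  assumes d: "labelled_diagram H d" and g: "g \<in> H"
    and M: "M \<in> matchings (outputs d) (new_slots d (snd g))"
  shows "labelled_diagram H (add_gate d g M)"
proof -
  note d' = labelled_diagramD[OF d]
  have sub: "M \<subseteq> outputs d \<times> new_slots d (snd g)" and inj: "inj_on fst M" "inj_on snd M"
    using M by (auto simp: matchings_def)
  have "fst ` conns d \<inter> fst ` M = {}"
    using sub by (force simp: outputs_def)
  moreover have "snd ` conns d \<inter> snd ` M = {}"
    using sub d'(1) new_slots_disjoint(2)[of d "snd g"] by fastforce
  ultimately have "inj_on fst (conns d \<union> M)" "inj_on snd (conns d \<union> M)"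
    using d'(2,3) inj by (auto simp: inj_on_Un)
  moreover have "i < j" if "((i, p), (j, q)) \<in> conns d \<union> M" for i p j q
    using that
  proof
    assume "((i, p), (j, q)) \<in> M"
    with sub show ?thesis by (auto simp: outputs_def out_slots_def new_slots_def)
  qed (rule d'(4))
  moreover have "\<forall>j\<in>{1..diagram_size (add_gate d g M)}. gate_type (add_gate d g M) j \<in> H"
    using d g by (auto simp: slots_snoc(3)[of _ d g] gate_type_snoc[of _ d g] labelled_diagram_def)
  moreover have "conns d \<union> M \<subseteq> out_slots (add_gate d g M) \<times> in_slots (add_gate d g M)"
    using d'(1) sub by (auto simp: slots_snoc[of _ d g] outputs_def)
  ultimately show ?thesis
    unfolding labelled_diagram_def by auto
qed

lemma card_outputs_inputs_add_gate:
  assumes d: "labelled_diagram H d"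
    and M: "M \<in> matchings (outputs d) (new_slots d (snd g))"
  shows "card (outputs (add_gate d g M)) = card (outputs d) - card M + fst g"
    and "card (inputs (add_gate d g M)) = card (inputs d) + (snd g - card M)"
proof -
  note d' = labelled_diagramD[OF d] and card = matching_card[OF M]
  have sub: "fst ` M \<subseteq> outputs d" "snd ` M \<subseteq> new_slots d (snd g)"
    using M by (auto simp: matchings_def)
  have subd: "fst ` conns d \<subseteq> out_slots d" "snd ` conns d \<subseteq> in_slots d"
    using d'(1) by auto
  have "outputs (add_gate d g M) = (outputs d - fst ` M) \<union> new_slots d (fst g)"
    using sub(1) subd(1) new_slots_disjoint(1)[of d "fst g"]
    by (auto simp: outputs_def slots_snoc[of _ d g] image_Un)
  moreover have "(outputs d - fst ` M) \<inter> new_slots d (fst g) = {}"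
    using new_slots_disjoint(1)[of d "fst g"] by (auto simp: outputs_def)
  ultimately show "card (outputs (add_gate d g M)) = card (outputs d) - card M + fst g"
    using card(3) by (simp add: card_Un_disjoint)
  have "inputs (add_gate d g M) = inputs d \<union> (new_slots d (snd g) - snd ` M)"
    using sub(2) subd(2) new_slots_disjoint(2)[of d "snd g"]
    by (auto simp: inputs_def slots_snoc[of _ d g] image_Un)
  moreover have "inputs d \<inter> (new_slots d (snd g) - snd ` M) = {}"
    using new_slots_disjoint(2)[of d "snd g"] by (auto simp: inputs_def)
  ultimately show "card (inputs (add_gate d g M)) = card (inputs d) + (snd g - card M)"
    using card(4) by (simp add: card_Un_disjoint)
qed

lemma diagram_weight_add_gate: "diagram_weight w (add_gate d g M) = w g * diagram_weight w d"
  by (simp add: diagram_weight_def slots_snoc(3)[of _ d g] gate_type_snoc[of _ d g] mult.commute)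

text \<open>
  A diagram is taken apart by deleting its last node. Labels increase along connections, so the
  last node has only incoming connections: its output slots are all outputs, and the connections
  into it start at slots that are outputs of the diagram that remains.
\<close>

lemma bij_betw_add_gate:
  "bij_betw (\<lambda>(d, g, M). add_gate d g M) (extensions H n) (diagrams_of_size H (Suc n))"
proof (rule bij_betw_byWitness[where
      f' = "\<lambda>d. (\<lparr>gates = butlast (gates d), conns = {c \<in> conns d. fst (snd c) \<le> n}\<rparr>,
        last (gates d), {c \<in> conns d. fst (snd c) = Suc n})"])
  let ?f = "\<lambda>(d, g, M). add_gate d g M"
  let ?f' = "\<lambda>d. (\<lparr>gates = butlast (gates d), conns = {c \<in> conns d. fst (snd c) \<le> n}\<rparr>,
        last (gates d), {c \<in> conns d. fst (snd c) = Suc n})"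
  have restrict: "?f' d' \<in> extensions H n \<and> ?f (?f' d') = d'" if "d' \<in> diagrams_of_size H (Suc n)" for d'
  proof -
    define d where "d = \<lparr>gates = butlast (gates d'), conns = {c \<in> conns d'. fst (snd c) \<le> n}\<rparr>"
    define g where "g = last (gates d')"
    define M where "M = {c \<in> conns d'. fst (snd c) = Suc n}"
    have d': "labelled_diagram H d'" "diagram_size d' = Suc n"
      using that by (auto simp: diagrams_of_size_def)
    note D = labelled_diagramD[OF d'(1)]
    have "gates d' \<noteq> []" using d'(2) by (auto simp: diagram_size_def)
    then have snoc: "gates d' = gates d @ [g]" by (simp add: d_def g_def)
    note slots = slots_snoc[OF snoc] gate_type_snoc[OF snoc]
    have size: "diagram_size d = n" using slots(3) d'(2) by simp
    have H: "gate_type d' j \<in> H" if "j \<in> {1..Suc n}" for j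
      using d' that by (simp add: labelled_diagram_def)
    have g: "g \<in> H" using H[of "Suc n"] slots(4)[of "Suc n"] by (simp add: size)
    \<comment> \<open>The source of any connection has a smaller label than its target, so it is an old slot.\<close>
    have node: "fst c \<in> out_slots d \<and>
        (fst (snd c) \<le> n \<and> snd c \<in> in_slots d \<or>
         fst (snd c) = Suc n \<and> snd c \<in> new_slots d (snd g))" if "c \<in> conns d'" for c
    proof -
      obtain i p j q where c: "c = ((i, p), (j, q))" by (metis surj_pair)
      have "(i, p) \<in> out_slots d \<union> new_slots d (fst g)" "(j, q) \<in> in_slots d \<union> new_slots d (snd g)"
        "i < j"
        using D(1) D(4)[of i p j q] that by (auto simp: c slots)
      then show ?thesis by (auto simp: c size in_slots_def out_slots_def new_slots_def)
    qed
    have conns: "conns d' = conns d \<union> M" "conns d \<inter> M = {}"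
      using node by (auto simp: d_def M_def)
    have "labelled_diagram H d"
      unfolding labelled_diagram_def
    proof (intro conjI)
      show "\<forall>j\<in>{1..diagram_size d}. gate_type d j \<in> H"
        using H slots(4) by (force simp: size)
      show "conns d \<subseteq> out_slots d \<times> in_slots d"
        using node by (force simp: d_def)
      show "\<forall>((i, p), (j, q))\<in>conns d. i < j"
        using D(4) by (auto simp: d_def)
      show "inj_on fst (conns d)" "inj_on snd (conns d)"
        using D(2,3) by (auto simp: conns inj_on_Un)
    qed
    moreover have "M \<in> matchings (outputs d) (new_slots d (snd g))"
    proof -
      have "fst c \<notin> fst ` conns d" if "c \<in> M" for c
        using that D(2) conns by (auto simp: inj_on_def)
      then have "c \<in> outputs d \<times> new_slots d (snd g)" if "c \<in> M" for c
        using that node[of c] by (auto simp: M_def outputs_def mem_Times_iff)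
      then have "M \<subseteq> outputs d \<times> new_slots d (snd g)" ..
      then show ?thesis
        using D(2,3) by (auto simp: matchings_def conns inj_on_Un)
    qed
    ultimately have "(d, g, M) \<in> extensions H n"
      using g size by (simp add: extensions_def diagrams_of_size_def)
    moreover have "add_gate d g M = d'"
      by (simp add: add_gate_def flip: snoc conns(1))
    ultimately show ?thesis by (simp add: d_def g_def M_def)
  qed
  show "\<forall>d\<in>diagrams_of_size H (Suc n). ?f (?f' d) = d"
    using restrict by blast
  show "?f' ` diagrams_of_size H (Suc n) \<subseteq> extensions H n"
    using restrict by blast
  show "?f ` extensions H n \<subseteq> diagrams_of_size H (Suc n)"
    by (auto simp: extensions_def diagrams_of_size_def labelled_diagram_add_gate slots_snoc(3))
  show "\<forall>t\<in>extensions H n. ?f' (?f t) = t"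
  proof
    fix t assume "t \<in> extensions H n"
    then obtain d g M where t: "t = (d, g, M)" and d: "labelled_diagram H d" "diagram_size d = n"
      and M: "M \<subseteq> outputs d \<times> new_slots d (snd g)"
      by (auto simp: extensions_def diagrams_of_size_def matchings_def)
    have "fst (snd c) \<le> n" if "c \<in> conns d" for c
      using labelled_diagramD(1)[OF d(1)] that d(2) by (auto simp: in_slots_def)
    moreover have "fst (snd c) = Suc n" if "c \<in> M" for c
      using M that d(2) by (auto simp: new_slots_def)
    ultimately have "{c \<in> conns d \<union> M. fst (snd c) \<le> n} = conns d"
      "{c \<in> conns d \<union> M. fst (snd c) = Suc n} = M"
      by fastforce+
    then show "?f' (?f t) = t" by (simp add: t)
  qed
qed

lemma diagrams_of_size_0: "diagrams_of_size H 0 = {\<lparr>gates = [], conns = {}\<rparr>}"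
  by (auto simp: diagrams_of_size_def labelled_diagram_def diagram_size_def out_slots_def
      intro!: diagram.equality)

lemma finite_diagrams_of_size:
  assumes "finite H"
  shows "finite (diagrams_of_size H n)"
proof (induction n)
  case 0
  then show ?case by (simp add: diagrams_of_size_0)
next
  case (Suc n)
  then have "finite (extensions H n)"
    using assms by (auto simp: extensions_def intro!: finite_SigmaI finite_matchings)
  then show ?case using bij_betw_finite[OF bij_betw_add_gate] by blast
qed

section \<open>Powers as sums over diagrams\<close>

text \<open>
  The exponents on both sides of one induction step agree because a new gate of type \<open>(r, s)\<close> with
  \<open>k\<close> connections turns \<open>A\<close> outputs and \<open>B\<close> inputs into \<open>A - k + r\<close> and \<open>B + s - k\<close>. New factors
  are put on the left, where the \<open>D\<close>'s of the new gate meet the \<open>X\<close>'s of the old diagram; this is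
  why input slots of later nodes are joined to output slots of earlier ones.
\<close>

lemma power_eq_sum_diagrams:
  fixes w :: "nat \<times> nat \<Rightarrow> 'k::field"
  assumes "finite H"
  shows "(\<Sum>(r, s)\<in>H. weyl_monom (w (r, s)) r s) ^ n =
    (\<Sum>d\<in>diagrams_of_size H n.
       weyl_monom (diagram_weight w d) (card (outputs d)) (card (inputs d)))"
proof (induction n)
  case 0
  show ?case
    by (simp add: diagrams_of_size_0 diagram_weight_def diagram_size_def outputs_def inputs_def
        out_slots_def in_slots_def weyl_monom_def weyl_const_one)
next
  case (Suc n)
  define m where
    "m d = weyl_monom (diagram_weight w d) (card (outputs d)) (card (inputs d))" for d
  have prod: "weyl_monom (w g) (fst g) (snd g) * m d =
      (\<Sum>M\<in>matchings (outputs d) (new_slots d (snd g)). m (add_gate d g M))"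
    if "d \<in> diagrams_of_size H n" for d g
  proof -
    have "labelled_diagram H d" using that by (simp add: diagrams_of_size_def)
    from card_outputs_inputs_add_gate[OF this] show ?thesis
      using weyl_monom_mult[of "outputs d" "new_slots d (snd g)"]
      by (simp add: m_def diagram_weight_add_gate add.commute)
  qed
  have "(\<Sum>(r, s)\<in>H. weyl_monom (w (r, s)) r s) ^ Suc n =
      (\<Sum>g\<in>H. weyl_monom (w g) (fst g) (snd g)) * (\<Sum>d\<in>diagrams_of_size H n. m d)"
    using Suc.IH by (simp add: m_def split_def)
  also have "\<dots> = (\<Sum>d\<in>diagrams_of_size H n. \<Sum>g\<in>H. weyl_monom (w g) (fst g) (snd g) * m d)"
    by (simp add: sum_distrib_left sum_distrib_right)
  also have "\<dots> = (\<Sum>d\<in>diagrams_of_size H n. \<Sum>g\<in>H.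
      \<Sum>M\<in>matchings (outputs d) (new_slots d (snd g)). m (add_gate d g M))"
    by (simp add: prod)
  also have "\<dots> = (\<Sum>(d, g, M)\<in>extensions H n. m (add_gate d g M))"
    unfolding extensions_def using assms
    by (simp add: sum.Sigma finite_diagrams_of_size finite_matchings)
  also have "\<dots> = (\<Sum>d\<in>diagrams_of_size H (Suc n). m d)"
    using sum.reindex_bij_betw[OF bij_betw_add_gate, of m] by (simp add: split_def)
  finally show ?case by (simp add: m_def)
qed

theorem theorem1:
  fixes H :: "(nat \<times> nat) set"
    and w :: "nat \<times> nat \<Rightarrow> 'k::field"
    and h :: "'k weyl"
    and n a b :: nat
  assumes "finite H"
    and "h = (\<Sum>(r, s)\<in>H. weyl_monom (w (r, s)) r s)"
  shows "Poly_Mapping.lookup (normal_form (h ^ n)) (a, b) = total_weight w (diagrams H n a b)"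
proof -
  have "diagrams H n a b =
      {d. d \<in> diagrams_of_size H n \<and> card (outputs d) = a \<and> card (inputs d) = b}"
    by (auto simp: diagrams_def diagrams_of_size_def)
  then show ?thesis
    using lookup_normal_form_sum[OF finite_diagrams_of_size[OF assms(1)]]
    by (simp add: assms(2) power_eq_sum_diagrams[OF assms(1)] total_weight_def)
qed

end
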